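(* Let $d=1$, $f(x)=x^2/2$, and let $N\ge 2$. For every step size $\eta>0$ there is a threshold $c_0>0$ (depending on $N$ and $\eta$) such that, if the initial ensemble has empirical variance $C_0\ge c_0$, then the forward Euler--Maruyama discretization of the affine invariant ensemble Langevin dynamics with step size $\eta$ satisfies $$\mathbb{P}\big(C_k\to\infty\text{ as }k\to\infty\big)>0,$$ where $C_k$ is the empirical variance of the ensemble at iteration $k$.
   Context: For an ensemble $x^{(k)}=(x_1^{(k)},\dots,x_N^{(k)})\in\mathbb{R}^N$ set $\bar x^{(k)}=\frac1N\sum_j x_j^{(k)}$ and $C_k=\frac1N\sum_j (x_j^{(k)}-\bar x^{(k)})^2$. For the one-dimensional target $\pi\propto e^{-x^2/2}$, the forward Euler--Maruyama discretization with step size $\eta>0$ is $$x_j^{(k+1)}=x_j^{(k)}-\eta C_k x_j^{(k)}+\frac{2\eta}{N}\big(x_j^{(k)}-\bar x^{(k)}\big)+\sqrt{2\eta C_k}\,\xi_j^{(k)},\qquad j=1,\dots,N,\ k\ge 0,$$ where $\xi_j^{(k)}$ are i.i.d. standard one-dimensional Gaussians and the initial ensemble $x^{(0)}$ is deterministic. *)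

theory Defs
  imports "HOL-Probability.Probability"
begin

text \<open>
  An ensemble in \<open>\<real>\<^sup>N\<close> is a function on indices of which only the values at \<open>1, \<dots>, N\<close> matter.
\<close>

definition emp_mean :: "nat \<Rightarrow> (nat \<Rightarrow> real) \<Rightarrow> real" where
  "emp_mean N x = (\<Sum>j=1..N. x j) / real N"

definition emp_var :: "nat \<Rightarrow> (nat \<Rightarrow> real) \<Rightarrow> real" where
  "emp_var N x = (\<Sum>j=1..N. (x j - emp_mean N x)\<^sup>2) / real N"

text \<open>
  Forward Euler--Maruyama discretization, with step size \<open>\<eta>\<close>, of the affine invariant ensemble
  Langevin dynamics for \<open>d = 1\<close> and \<open>f x = x\<^sup>2 / 2\<close>, started at \<open>x0\<close> and driven by the
  noise path \<open>z\<close>. The factor \<open>x j\<close> in the drift is \<open>f'\<close> evaluated at \<open>x j\<close>, and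
  the \<open>2\<close> in the correction term is \<open>d + 1\<close>.
\<close>

primrec aldi_em :: "nat \<Rightarrow> real \<Rightarrow> (nat \<Rightarrow> real) \<Rightarrow> (nat \<Rightarrow> nat \<Rightarrow> real) \<Rightarrow> nat \<Rightarrow> nat \<Rightarrow> real" where
  "aldi_em N \<eta> x0 z 0 = x0"
| "aldi_em N \<eta> x0 z (Suc k) =
     (let x = aldi_em N \<eta> x0 z k; C = emp_var N x in
      (\<lambda>j. x j - \<eta> * C * x j + 2 * \<eta> / real N * (x j - emp_mean N x) + sqrt (2 * \<eta> * C) * z k j))"

end

theory Submission imports Defs begin

text \<open>
  The drift \<open>- C x\<close> is cubic in the ensemble, so an explicit step overshoots once the
  variance is large. Subtracting means, the deviations evolve by
  \<open>y' = (1 - \<eta> C + 2 \<eta> / N) y + sqrt (2 \<eta> C) (z - mean z)\<close>, and the triangle inequality gives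
  \<open>sqrt C' \<ge> sqrt C (\<eta> C - 1 - 2 \<eta> / N - sqrt (2 \<eta>) v)\<close>, where \<open>v\<close> is the empirical standard
  deviation of the noise. Hence the variance at least quadruples as soon as \<open>\<eta> C\<close> exceeds
  \<open>3 + 2 \<eta> / N + sqrt (2 \<eta>) v\<close> (lemma \<open>emp_var_aldi_em_quadruples\<close>). Quadrupling makes the
  tolerated noise level grow geometrically as well, so with one threshold \<open>c0\<close> the condition
  propagates for ever along every noise path with \<open>v k \<le> 2 * 4 ^ k\<close>
  (lemma \<open>aldi_em_diverges\<close>).

  Such paths have positive probability because \<open>v k\<close> is bounded by the root mean square of the
  noise, whose square has expectation \<open>1\<close>. The sum over \<open>k\<close> of these squares with weights
  \<open>(1/2) ^ Suc k\<close> therefore has expectation \<open>1\<close>, hence is below \<open>2\<close> with positive probability;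
  where it is, every single square is at most \<open>4 * 2 ^ k\<close>
  (lemma \<open>moderate_noise_positive\<close>).
\<close>

section \<open>Empirical standard deviation as a seminorm\<close>

lemma emp_mean_affine:
  assumes "N > 0"
  shows "emp_mean N (\<lambda>j. a * x j + b + s * z j) = a * emp_mean N x + b + s * emp_mean N z"
  using assms
  by (simp add: emp_mean_def sum.distrib sum_distrib_left[symmetric] add_divide_distrib)

lemma sqrt_emp_var:
  "sqrt (emp_var N x) = L2_set (\<lambda>j. x j - emp_mean N x) {1..N} / sqrt (real N)"
  by (simp add: emp_var_def L2_set_def real_sqrt_divide)

lemma emp_var_nonneg: "emp_var N x \<ge> 0"
  by (simp add: emp_var_def sum_nonneg)

text \<open>
  The reverse triangle inequality for the norm of the deviations; translations drop out because
  they move the mean along.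
\<close>

lemma sqrt_emp_var_affine_ge:
  assumes "N > 0"
  shows "sqrt (emp_var N (\<lambda>j. a * x j + b + s * z j))
           \<ge> \<bar>a\<bar> * sqrt (emp_var N x) - \<bar>s\<bar> * sqrt (emp_var N z)"
proof -
  define d where "d = (\<lambda>j. x j - emp_mean N x)"
  define e where "e = (\<lambda>j. z j - emp_mean N z)"
  have scale: "L2_set (\<lambda>j. c * f j) {1..N} = \<bar>c\<bar> * L2_set f {1..N}" for c f
    by (simp add: L2_set_def power_mult_distrib sum_distrib_left[symmetric] real_sqrt_mult)
  have dev: "a * x j + b + s * z j - emp_mean N (\<lambda>j. a * x j + b + s * z j) = a * d j + s * e j" for j
    unfolding emp_mean_affine[OF assms] by (simp add: d_def e_def algebra_simps)
  have "\<bar>a\<bar> * L2_set d {1..N} = L2_set (\<lambda>j. (a * d j + s * e j) + (- s) * e j) {1..N}"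
    by (simp add: scale del: One_nat_def)
  also have "\<dots> \<le> L2_set (\<lambda>j. a * d j + s * e j) {1..N} + L2_set (\<lambda>j. (- s) * e j) {1..N}"
    by (rule L2_set_triangle_ineq)
  finally have "\<bar>a\<bar> * L2_set d {1..N} - \<bar>s\<bar> * L2_set e {1..N}
                  \<le> L2_set (\<lambda>j. a * d j + s * e j) {1..N}"
    unfolding scale by simp
  then have "(\<bar>a\<bar> * L2_set d {1..N} - \<bar>s\<bar> * L2_set e {1..N}) / sqrt (real N)
                  \<le> L2_set (\<lambda>j. a * d j + s * e j) {1..N} / sqrt (real N)"
    by (rule divide_right_mono) simp
  then show ?thesis
    unfolding sqrt_emp_var dev by (simp add: d_def e_def diff_divide_distrib)
qed

lemma emp_var_le_mean_square: "emp_var N x \<le> (\<Sum>j=1..N. (x j)\<^sup>2) / real N"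
proof (cases "N = 0")
  case False
  define m where "m = emp_mean N x"
  have m: "(\<Sum>j=1..N. x j) = real N * m"
    using False by (simp add: m_def emp_mean_def)
  have "(\<Sum>j=1..N. (x j - m)\<^sup>2) = (\<Sum>j=1..N. (x j)\<^sup>2) - 2 * m * (\<Sum>j=1..N. x j) + real N * m\<^sup>2"
    by (simp add: power2_diff sum.distrib sum_subtractf sum_distrib_left mult_ac)
  also have "\<dots> = (\<Sum>j=1..N. (x j)\<^sup>2) - real N * m\<^sup>2"
    unfolding m by (simp add: power2_eq_square)
  also have "\<dots> \<le> (\<Sum>j=1..N. (x j)\<^sup>2)"
    by simp
  finally show ?thesis
    by (simp add: emp_var_def m_def divide_right_mono)
qed (simp add: emp_var_def)

section \<open>Pathwise divergence under moderate noise\<close>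

text \<open>
  Both the deviations and the noise amplitude \<open>sqrt (2 * \<eta> * C)\<close> scale with \<open>sqrt C\<close>, so after
  dividing by \<open>sqrt C\<close> a noise of fixed size is beaten by the factor
  \<open>\<bar>1 - \<eta> * C + 2 * \<eta> / real N\<bar>\<close>, which grows with \<open>C\<close>.
\<close>

lemma emp_var_aldi_em_quadruples:
  assumes N: "N > 0" and \<eta>: "\<eta> > 0"
    and C: "C = emp_var N (aldi_em N \<eta> x0 z k)"
    and large: "\<eta> * C \<ge> 3 + 2 * \<eta> / real N + sqrt (2 * \<eta>) * sqrt (emp_var N (z k))"
  shows "emp_var N (aldi_em N \<eta> x0 z (Suc k)) \<ge> 4 * C"
proof -
  define x where "x = aldi_em N \<eta> x0 z k"
  define a where "a = 1 - \<eta> * C + 2 * \<eta> / real N"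
  define v where "v = sqrt (emp_var N (z k))"
  have C0: "C \<ge> 0" using C emp_var_nonneg by simp
  have step: "aldi_em N \<eta> x0 z (Suc k)
      = (\<lambda>j. a * x j + (- (2 * \<eta> / real N) * emp_mean N x) + sqrt (2 * \<eta> * C) * z k j)"
    by (simp add: Let_def C x_def a_def algebra_simps diff_divide_distrib)
  have "2 * sqrt C \<le> (\<eta> * C - 1 - 2 * \<eta> / real N - sqrt (2 * \<eta>) * v) * sqrt C"
    using large C0 by (intro mult_right_mono) (simp_all add: v_def)
  also have "\<dots> \<le> (\<bar>a\<bar> - sqrt (2 * \<eta>) * v) * sqrt C"
    using C0 by (intro mult_right_mono) (simp_all add: a_def)
  also have "\<dots> = \<bar>a\<bar> * sqrt (emp_var N x) - \<bar>sqrt (2 * \<eta> * C)\<bar> * sqrt (emp_var N (z k))"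
    using C0 \<eta> by (simp add: v_def C x_def real_sqrt_mult algebra_simps)
  also have "\<dots> \<le> sqrt (emp_var N (aldi_em N \<eta> x0 z (Suc k)))"
    unfolding step by (rule sqrt_emp_var_affine_ge[OF N])
  finally have "sqrt (4 * C) \<le> sqrt (emp_var N (aldi_em N \<eta> x0 z (Suc k)))"
    by (simp add: real_sqrt_mult)
  then show ?thesis by (simp only: real_sqrt_le_iff)
qed

text \<open>
  The threshold is what the one-step condition asks for at time \<open>0\<close>. Multiplied by \<open>4 ^ k\<close> it
  still dominates the condition at time \<open>k\<close>, whose noise term grows at the same rate.
\<close>

lemma aldi_em_diverges:
  assumes N: "N > 0" and \<eta>: "\<eta> > 0"
    and init: "emp_var N x0 \<ge> (3 + 2 * \<eta> / real N + 2 * sqrt (2 * \<eta>)) / \<eta>" (is "_ \<ge> ?c")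
    and noise: "\<And>k. sqrt (emp_var N (z k)) \<le> 2 * 4 ^ k"
  shows "filterlim (\<lambda>k. emp_var N (aldi_em N \<eta> x0 z k)) at_top sequentially"
proof -
  have c: "?c > 0" using N \<eta> by (intro divide_pos_pos add_pos_nonneg) auto
  have growth: "emp_var N (aldi_em N \<eta> x0 z k) \<ge> ?c * 4 ^ k" for k
  proof (induction k)
    case 0
    then show ?case using init by simp
  next
    case (Suc k)
    have "3 + 2 * \<eta> / real N + sqrt (2 * \<eta>) * sqrt (emp_var N (z k))
            \<le> (3 + 2 * \<eta> / real N) * 4 ^ k + sqrt (2 * \<eta>) * (2 * 4 ^ k)"
    proof (rule add_mono)
      have "(3 + 2 * \<eta> / real N) * 1 \<le> (3 + 2 * \<eta> / real N) * 4 ^ k"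
        using \<eta> by (intro mult_left_mono) auto
      then show "3 + 2 * \<eta> / real N \<le> (3 + 2 * \<eta> / real N) * 4 ^ k" by simp
    qed (use \<eta> noise in \<open>auto intro: mult_left_mono\<close>)
    also have "\<dots> = \<eta> * (?c * 4 ^ k)"
      using \<eta> by (simp add: field_simps)
    also have "\<dots> \<le> \<eta> * emp_var N (aldi_em N \<eta> x0 z k)"
      using Suc \<eta> by (intro mult_left_mono) auto
    finally have "4 * emp_var N (aldi_em N \<eta> x0 z k) \<le> emp_var N (aldi_em N \<eta> x0 z (Suc k))"
      by (rule emp_var_aldi_em_quadruples[OF N \<eta> refl])
    then show ?case using Suc by simp
  qed
  have "filterlim (\<lambda>k. ?c * 4 ^ k) at_top sequentially"
    by (rule filterlim_tendsto_pos_mult_at_top[OF tendsto_const c])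
       (auto intro!: filterlim_at_infinity_imp_filterlim_at_top filterlim_realpow_sequentially_gt1)
  then show ?thesis
    by (rule filterlim_at_top_mono) (use growth in auto)
qed

section \<open>Measurability of divergence\<close>

lemma borel_measurable_emp_var:
  assumes "\<And>j. j \<in> {1..N} \<Longrightarrow> (\<lambda>\<omega>. x \<omega> j) \<in> borel_measurable M"
  shows "(\<lambda>\<omega>. emp_var N (x \<omega>)) \<in> borel_measurable M"
  unfolding emp_var_def emp_mean_def using assms
  by (intro borel_measurable_divide borel_measurable_sum borel_measurable_power
      borel_measurable_diff borel_measurable_const) auto

lemma borel_measurable_aldi_em:
  assumes "\<And>k j. j \<in> {1..N} \<Longrightarrow> \<xi> k j \<in> borel_measurable M" and "j \<in> {1..N}"
  shows "(\<lambda>\<omega>. aldi_em N \<eta> x0 (\<lambda>k j. \<xi> k j \<omega>) k j) \<in> borel_measurable M"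
  using assms(2)
proof (induction k arbitrary: j)
  case (Suc k)
  let ?x = "\<lambda>\<omega>. aldi_em N \<eta> x0 (\<lambda>k j. \<xi> k j \<omega>) k"
  note [measurable] = Suc.IH[OF Suc.prems] assms(1)[OF Suc.prems]
  have [measurable]: "(\<lambda>\<omega>. emp_mean N (?x \<omega>)) \<in> borel_measurable M"
    unfolding emp_mean_def using Suc.IH by (intro borel_measurable_divide borel_measurable_sum) auto
  have [measurable]: "(\<lambda>\<omega>. emp_var N (?x \<omega>)) \<in> borel_measurable M"
    by (rule borel_measurable_emp_var) (rule Suc.IH)
  show ?case by (simp add: Let_def)
qed simp

lemma sets_filterlim_at_top:
  fixes f :: "nat \<Rightarrow> 'a \<Rightarrow> real"
  assumes [measurable]: "\<And>k. f k \<in> borel_measurable M"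
  shows "{\<omega> \<in> space M. filterlim (\<lambda>k. f k \<omega>) at_top sequentially} \<in> sets M"
proof -
  have "filterlim (\<lambda>k. f k \<omega>) at_top sequentially \<longleftrightarrow> (\<forall>n::nat. \<exists>K. \<forall>k\<in>{K..}. real n \<le> f k \<omega>)" for \<omega>
  proof
    assume "\<forall>n::nat. \<exists>K. \<forall>k\<in>{K..}. real n \<le> f k \<omega>"
    then show "filterlim (\<lambda>k. f k \<omega>) at_top sequentially"
      unfolding filterlim_at_top eventually_sequentially
      by (meson atLeast_iff order_trans real_arch_simple)
  qed (auto simp only: filterlim_at_top eventually_sequentially atLeast_iff Ball_def)
  then show ?thesis by simp
qed

section \<open>Moderate noise has positive probability\<close>

lemma (in prob_space) nn_integral_square_std_normal:
  assumes "distributed M lborel X std_normal_density"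
  shows "(\<integral>\<^sup>+ \<omega>. ennreal ((X \<omega>)\<^sup>2) \<partial>M) = 1"
proof -
  have "(\<integral>\<^sup>+ \<omega>. ennreal ((X \<omega>)\<^sup>2) \<partial>M) = (\<integral>\<^sup>+ x. ennreal (std_normal_density x) * ennreal (x\<^sup>2) \<partial>lborel)"
    by (rule distributed_nn_integral[OF assms, symmetric]) simp
  also have "\<dots> = (\<integral>\<^sup>+ x. ennreal (std_normal_density x * x\<^sup>2) \<partial>lborel)"
    by (simp add: ennreal_mult)
  also have "\<dots> = ennreal 1"
    using std_normal_moment_even[of 1]
    by (intro nn_integral_eq_integral[OF has_bochner_integral_iff[THEN iffD1, THEN conjunct1] , THEN trans])
       (auto simp: has_bochner_integral_iff)
  finally show ?thesis by simp
qed

text \<open>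
  A nonnegative function with integral \<open>1\<close> is less than \<open>2\<close> on a set of positive measure; it is
  applied to a weighted sum over all times and particles, so that one event controls the whole path.

  The bound \<open>2 * 4 ^ k\<close> is coarser than the \<open>2 * sqrt 2 ^ k\<close> obtained this way; it matches the
  growth rate of the variance.
\<close>

lemma (in prob_space) moderate_noise_positive:
  assumes N: "N > 0"
    and dist: "\<And>k j. j \<in> {1..N} \<Longrightarrow> distributed M lborel (\<xi> k j) std_normal_density"
    and A: "A \<in> events"
    and moderate: "\<And>\<omega>. \<omega> \<in> space M \<Longrightarrow> (\<And>k. sqrt (emp_var N (\<lambda>j. \<xi> k j \<omega>)) \<le> 2 * 4 ^ k) \<Longrightarrow> \<omega> \<in> A"
  shows "prob A > 0"
proof (rule ccontr)
  assume "\<not> prob A > 0"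
  then have A0: "emeasure M A = 0"
    by (simp add: emeasure_eq_measure zero_less_measure_iff)
  define q where "q k \<omega> = (\<Sum>j=1..N. (\<xi> k j \<omega>)\<^sup>2) / real N" for k \<omega>
  define S where "S \<omega> = (\<Sum>k. ennreal ((1/2) ^ Suc k) * ennreal (q k \<omega>))" for \<omega>
  have \<xi>: "\<xi> k j \<in> borel_measurable M" if "j \<in> {1..N}" for k j
    using dist[OF that] by (auto simp: distributed_def)
  have q0: "q k \<omega> \<ge> 0" for k \<omega> by (simp add: q_def sum_nonneg)
  have [measurable]: "q k \<in> borel_measurable M" for k
    unfolding q_def using \<xi> by (intro borel_measurable_divide borel_measurable_sum borel_measurable_power) auto
  have sq: "(\<lambda>\<omega>. ennreal ((\<xi> k j \<omega>)\<^sup>2)) \<in> borel_measurable M" if "j \<in> {1..N}" for k j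
    by (intro measurable_compose[OF _ measurable_ennreal] borel_measurable_power \<xi> that)
  have "(\<integral>\<^sup>+ \<omega>. ennreal (q k \<omega>) \<partial>M) = 1" for k
  proof -
    have "(\<integral>\<^sup>+ \<omega>. ennreal (q k \<omega>) \<partial>M)
        = (\<integral>\<^sup>+ \<omega>. ennreal (1 / real N) * (\<Sum>j=1..N. ennreal ((\<xi> k j \<omega>)\<^sup>2)) \<partial>M)"
      by (simp add: q_def sum_ennreal ennreal_mult[symmetric] sum_nonneg)
    also have "\<dots> = ennreal (1 / real N) * (\<Sum>j=1..N. \<integral>\<^sup>+ \<omega>. ennreal ((\<xi> k j \<omega>)\<^sup>2) \<partial>M)"
      by (simp only: nn_integral_cmult[OF borel_measurable_sum[OF sq]] nn_integral_sum[OF sq])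
    also have "\<dots> = ennreal (1 / real N) * of_nat N"
      by (simp add: nn_integral_square_std_normal[OF dist])
    also have "\<dots> = 1"
      using N by (simp add: ennreal_of_nat_eq_real_of_nat ennreal_mult[symmetric])
    finally show ?thesis .
  qed
  then have "(\<integral>\<^sup>+ \<omega>. S \<omega> \<partial>M) = (\<Sum>k. ennreal ((1/2) ^ Suc k))"
    unfolding S_def by (simp add: nn_integral_suminf nn_integral_cmult del: power_Suc)
  also have "\<dots> = ennreal 1"
    by (rule suminf_ennreal_eq[OF _ power_half_series]) simp
  finally have S1: "(\<integral>\<^sup>+ \<omega>. S \<omega> \<partial>M) = 1" by simp
  have S2: "2 \<le> S \<omega>" if \<omega>: "\<omega> \<in> space M" "\<omega> \<notin> A" for \<omega>
  proof (rule ccontr)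
    assume "\<not> 2 \<le> S \<omega>"
    then have less: "S \<omega> < 2" by simp
    have "sqrt (emp_var N (\<lambda>j. \<xi> k j \<omega>)) \<le> 2 * 4 ^ k" for k
    proof -
      have "ennreal ((1/2) ^ Suc k * q k \<omega>) = (\<Sum>i\<in>{k}. ennreal ((1/2) ^ Suc i) * ennreal (q i \<omega>))"
        by (simp add: ennreal_mult q0 del: power_Suc)
      also have "\<dots> \<le> S \<omega>"
        unfolding S_def by (rule sum_le_suminf) auto
      also have "\<dots> \<le> ennreal 2" using less by simp
      finally have "(1/2) ^ Suc k * q k \<omega> \<le> 2"
        by (simp only: ennreal_le_iff zero_le_numeral)
      then have "q k \<omega> \<le> 4 * 2 ^ k" by (simp add: field_simps)
      also have "\<dots> \<le> 4 * 16 ^ k" by (intro mult_left_mono power_mono) auto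
      also have "\<dots> = (2 * 4 ^ k)\<^sup>2"
        by (simp add: power2_eq_square flip: power_mult_distrib)
      finally have "emp_var N (\<lambda>j. \<xi> k j \<omega>) \<le> (2 * 4 ^ k)\<^sup>2"
        using emp_var_le_mean_square[of N "\<lambda>j. \<xi> k j \<omega>"] by (simp add: q_def)
      then show ?thesis by (intro real_le_lsqrt) auto
    qed
    with moderate \<omega> show False by blast
  qed
  have "AE \<omega> in M. \<omega> \<notin> A"
    using A A0 by (intro AE_not_in) auto
  then have "AE \<omega> in M. 2 \<le> S \<omega>"
    using AE_space by eventually_elim (rule S2)
  then have "(\<integral>\<^sup>+ \<omega>. 2 \<partial>M) \<le> (\<integral>\<^sup>+ \<omega>. S \<omega> \<partial>M)"
    by (rule nn_integral_mono_AE)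
  then show False
    using S1 by (simp add: emeasure_space_1)
qed

theorem mainTheorem3:
  fixes N :: nat and \<eta> :: real
  assumes "N \<ge> 2" and "\<eta> > 0"
  shows "\<exists>c0>0. \<forall>(M :: 'a measure) (\<xi> :: nat \<Rightarrow> nat \<Rightarrow> 'a \<Rightarrow> real) (x0 :: nat \<Rightarrow> real).
           prob_space M \<longrightarrow>
           prob_space.indep_vars M (\<lambda>_. borel) (\<lambda>(k, j). \<xi> k j) (UNIV \<times> {1..N}) \<longrightarrow>
           (\<forall>k. \<forall>j\<in>{1..N}. distributed M lborel (\<xi> k j) std_normal_density) \<longrightarrow>
           emp_var N x0 \<ge> c0 \<longrightarrow>
           measure M {\<omega> \<in> space M.
             filterlim (\<lambda>k. emp_var N (aldi_em N \<eta> x0 (\<lambda>k j. \<xi> k j \<omega>) k)) at_top sequentially} > 0"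
proof -
  define c0 where "c0 = (3 + 2 * \<eta> / real N + 2 * sqrt (2 * \<eta>)) / \<eta>"
  have N: "N > 0" using assms(1) by simp
  have c0: "c0 > 0"
    unfolding c0_def using assms by (intro divide_pos_pos add_pos_nonneg) auto
  show ?thesis
  proof (intro exI[of _ c0] conjI allI impI c0)
    fix M :: "'a measure" and \<xi> :: "nat \<Rightarrow> nat \<Rightarrow> 'a \<Rightarrow> real" and x0 :: "nat \<Rightarrow> real"
    assume M: "prob_space M"
      and dist: "\<forall>k. \<forall>j\<in>{1..N}. distributed M lborel (\<xi> k j) std_normal_density"
      and init: "emp_var N x0 \<ge> c0"
    let ?C = "\<lambda>k \<omega>. emp_var N (aldi_em N \<eta> x0 (\<lambda>k j. \<xi> k j \<omega>) k)"
    have \<xi>: "\<xi> k j \<in> borel_measurable M" if "j \<in> {1..N}" for k j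
      using dist that by (auto simp: distributed_def)
    show "measure M {\<omega> \<in> space M. filterlim (\<lambda>k. ?C k \<omega>) at_top sequentially} > 0"
    proof (rule prob_space.moderate_noise_positive[OF M N, where \<xi> = \<xi>])
      show "{\<omega> \<in> space M. filterlim (\<lambda>k. ?C k \<omega>) at_top sequentially} \<in> sets M"
        by (intro sets_filterlim_at_top borel_measurable_emp_var borel_measurable_aldi_em \<xi>)
    qed (use dist aldi_em_diverges[OF N assms(2)] init in \<open>auto simp: c0_def\<close>)
  qed
qed

end
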